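(* For every constant integer $k\ge 3$ there is a choice of the parameter $\rho$ such that, for every $n$, there is a graph with $\Theta(n)$ vertices on which the approximation ratio of $k\rho$-DP is at least $n-1$, and the approximation ratio of $k\rho$-Greedy is $\Omega(n^2)$.
   Context: For a weighted undirected graph $G=(V,E)$: $d(u,v)$ is the minimum path weight; $\hat d(u,v)$ is the minimum number of edges over paths of weight $d(u,v)$ ($\infty$ if disconnected). $\bar r_k(u)=\min_{v:\ \hat d(u,v)>k} d(u,v)$; $r_\rho(u)$ is the distance to the $\rho$-th closest vertex; $v$ has a $(k,\rho)$-ball iff $r_\rho(v)<\bar r_k(v)$; a $(k,\rho)$-graph is one where every vertex has a $(k,\rho)$-ball. A shortcut between distinct $u,v$ with $d(u,v)<\infty$, $\hat d(u,v)>1$ is a new edge $\{u,v\}$ of weight $d(u,v)$. $k\rho$-MSP: find a minimum-cardinality shortcut set $S$ making $(V,E\cup S)$ a $(k,\rho)$-graph. The approximation ratio of a heuristic on an instance is the number of shortcuts it outputs divided by the optimum number. Heuristic $k\rho$-DP: for each source $s\in V$ independently, let $T_s$ be a shortest-path tree from $s$ to its $\rho$ nearest neighbours such that for each $v\in T_s$ the tree path from $s$ to $v$ has $\hat d(s,v)$ edges. For a node $u\ne s$ of $T_s$ whose parent is at (current) depth $t$, define $F(u,t)=\infty$ if $t\ge k$, and otherwise $F(u,t)=\min\big(1+\sum_{w \text{ child of } u}F(w,1),\ \sum_{w \text{ child of } u}F(w,t+1)\big)$, where the first option corresponds to adding the shortcut $\{s,u\}$. The shortcuts $S_s$ chosen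 for $s$ are those (all incident to $s$) realizing the minimum $\sum_{u \text{ child of } s}F(u,0)$; the output is $\bigcup_s S_s$. Heuristic $k\rho$-Greedy: for every vertex $u$, add a shortcut from $u$ to every vertex among its $\rho$ nearest neighbours whose hop distance from $u$ exceeds $k$. *)

theory Defs
  imports "HOL-Library.Extended_Nat" "HOL-Library.Extended_Real" "HOL-Library.Landau_Symbols"
begin

record 'a wgraph =
  verts :: "'a set"
  edges :: "'a set set"
  weight :: "'a set \<Rightarrow> real"

definition wf_wgraph :: "'a wgraph \<Rightarrow> bool" where
  "wf_wgraph G \<longleftrightarrow> finite (verts G) \<and>
     (\<forall>e\<in>edges G. (\<exists>u\<in>verts G. \<exists>v\<in>verts G. u \<noteq> v \<and> e = {u, v}) \<and> weight G e > 0)"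

fun path_edges :: "'a list \<Rightarrow> 'a set list" where
  "path_edges (u # v # p) = {u, v} # path_edges (v # p)"
| "path_edges _ = []"

definition paths :: "'a wgraph \<Rightarrow> 'a \<Rightarrow> 'a \<Rightarrow> 'a list set" where
  "paths G u v = {p. p \<noteq> [] \<and> hd p = u \<and> last p = v \<and> distinct p \<and>
     set p \<subseteq> verts G \<and> set (path_edges p) \<subseteq> edges G}"

definition path_weight :: "'a wgraph \<Rightarrow> 'a list \<Rightarrow> real" where
  "path_weight G p = (\<Sum>e\<leftarrow>path_edges p. weight G e)"

definition gdist :: "'a wgraph \<Rightarrow> 'a \<Rightarrow> 'a \<Rightarrow> ereal" where
  "gdist G u v = (INF p\<in>paths G u v. ereal (path_weight G p))"

definition hopdist :: "'a wgraph \<Rightarrow> 'a \<Rightarrow> 'a \<Rightarrow> enat" where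
  "hopdist G u v = (INF p\<in>{p \<in> paths G u v. ereal (path_weight G p) = gdist G u v}.
     enat (length (path_edges p)))"

definition rbar :: "nat \<Rightarrow> 'a wgraph \<Rightarrow> 'a \<Rightarrow> ereal" where
  "rbar k G u = (INF v\<in>{v \<in> verts G. hopdist G u v > enat k}. gdist G u v)"

(* Distance to the rho-th closest vertex, where u itself is not counted; it is infinite
   if fewer than rho other vertices can be reached. *)
definition near_radius :: "nat \<Rightarrow> 'a wgraph \<Rightarrow> 'a \<Rightarrow> ereal" where
  "near_radius \<rho> G u = Inf {r. card {v \<in> verts G - {u}. gdist G u v \<le> r} \<ge> \<rho>}"

definition has_krho_ball :: "nat \<Rightarrow> nat \<Rightarrow> 'a wgraph \<Rightarrow> 'a \<Rightarrow> bool" where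
  "has_krho_ball k \<rho> G v \<longleftrightarrow> near_radius \<rho> G v < rbar k G v"

definition krho_graph :: "nat \<Rightarrow> nat \<Rightarrow> 'a wgraph \<Rightarrow> bool" where
  "krho_graph k \<rho> G \<longleftrightarrow> (\<forall>v\<in>verts G. has_krho_ball k \<rho> G v)"

definition is_shortcut :: "'a wgraph \<Rightarrow> 'a set \<Rightarrow> bool" where
  "is_shortcut G e \<longleftrightarrow> (\<exists>u\<in>verts G. \<exists>v\<in>verts G. e = {u, v} \<and> u \<noteq> v \<and>
     gdist G u v < \<infinity> \<and> hopdist G u v > 1)"

(* A shortcut may join two vertices whose edge in G is heavier than their distance. It then
   overrides the weight of that edge, which affects distances and hop distances exactly as
   a parallel edge would. *)
definition add_shortcuts :: "'a wgraph \<Rightarrow> 'a set set \<Rightarrow> 'a wgraph" where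
  "add_shortcuts G S = \<lparr>verts = verts G, edges = edges G \<union> S,
     weight = (\<lambda>e. if e \<in> S then THE r. \<exists>u v. e = {u, v} \<and> gdist G u v = ereal r
                   else weight G e)\<rparr>"

definition msp_feasible :: "nat \<Rightarrow> nat \<Rightarrow> 'a wgraph \<Rightarrow> 'a set set \<Rightarrow> bool" where
  "msp_feasible k \<rho> G S \<longleftrightarrow>
     (\<forall>e\<in>S. is_shortcut G e) \<and> krho_graph k \<rho> (add_shortcuts G S)"

(* Unspecified if there is no feasible shortcut set. *)
definition msp_opt :: "nat \<Rightarrow> nat \<Rightarrow> 'a wgraph \<Rightarrow> nat" where
  "msp_opt k \<rho> G = Inf (card ` {S. msp_feasible k \<rho> G S})"

definition approx_ratio :: "nat \<Rightarrow> nat \<Rightarrow> 'a wgraph \<Rightarrow> 'a set set \<Rightarrow> real" where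
  "approx_ratio k \<rho> G S = real (card S) / real (msp_opt k \<rho> G)"

definition reachable :: "'a wgraph \<Rightarrow> 'a \<Rightarrow> 'a set" where
  "reachable G s = {v \<in> verts G - {s}. gdist G s v < \<infinity>}"

(* N is an admissible choice of the rho nearest neighbours of s: ties are broken arbitrarily,
   and all reachable vertices are taken if there are fewer than rho of them. *)
definition nearest_nbrs :: "nat \<Rightarrow> 'a wgraph \<Rightarrow> 'a \<Rightarrow> 'a set \<Rightarrow> bool" where
  "nearest_nbrs \<rho> G s N \<longleftrightarrow> N \<subseteq> reachable G s \<and>
     card N = min \<rho> (card (reachable G s)) \<and>
     (\<forall>x\<in>N. \<forall>y\<in>reachable G s - N. gdist G s x \<le> gdist G s y)"

definition greedy_output :: "nat \<Rightarrow> nat \<Rightarrow> 'a wgraph \<Rightarrow> 'a set set \<Rightarrow> bool" where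
  "greedy_output k \<rho> G S \<longleftrightarrow> (\<exists>N. (\<forall>u\<in>verts G. nearest_nbrs \<rho> G u (N u)) \<and>
     S = {{u, v} | u v. u \<in> verts G \<and> v \<in> N u \<and> hopdist G u v > enat k})"

datatype 'a rtree = Node (root: 'a) (children: "'a rtree list")

fun preorder :: "'a rtree \<Rightarrow> 'a list" where
  "preorder (Node u cs) = u # concat (map preorder cs)"

fun root_paths :: "'a rtree \<Rightarrow> 'a list set" where
  "root_paths (Node u cs) = insert [u] ((#) u ` (\<Union>c\<in>set cs. root_paths c))"

definition sp_tree :: "nat \<Rightarrow> 'a wgraph \<Rightarrow> 'a \<Rightarrow> 'a rtree \<Rightarrow> bool" where
  "sp_tree \<rho> G s T \<longleftrightarrow> root T = s \<and> distinct (preorder T) \<and>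
     nearest_nbrs \<rho> G s (set (preorder T) - {s}) \<and>
     (\<forall>p\<in>root_paths T. p \<in> paths G s (last p) \<and>
        ereal (path_weight G p) = gdist G s (last p) \<and>
        enat (length (path_edges p)) = hopdist G s (last p))"

fun dp_F :: "nat \<Rightarrow> 'a rtree \<Rightarrow> nat \<Rightarrow> enat" where
  "dp_F k (Node u cs) t =
     (if t \<ge> k then \<infinity>
      else min (1 + (\<Sum>w\<leftarrow>cs. dp_F k w 1)) (\<Sum>w\<leftarrow>cs. dp_F k w (t + 1)))"

(* The value obtained from the recursion of dp_F when, instead of minimizing, the first option
   is taken exactly at the nodes in X. *)
fun dp_cost :: "nat \<Rightarrow> 'a set \<Rightarrow> 'a rtree \<Rightarrow> nat \<Rightarrow> enat" where
  "dp_cost k X (Node u cs) t =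
     (if t \<ge> k then \<infinity>
      else if u \<in> X then 1 + (\<Sum>w\<leftarrow>cs. dp_cost k X w 1)
      else (\<Sum>w\<leftarrow>cs. dp_cost k X w (t + 1)))"

definition dp_choice :: "nat \<Rightarrow> 'a rtree \<Rightarrow> 'a set \<Rightarrow> bool" where
  "dp_choice k T X \<longleftrightarrow> X \<subseteq> set (preorder T) - {root T} \<and>
     (\<Sum>u\<leftarrow>children T. dp_cost k X u 0) = (\<Sum>u\<leftarrow>children T. dp_F k u 0)"

(* Both the shortest-path trees and the minimizing choices need not be unique; every
   combination is a possible output. *)
definition dp_output :: "nat \<Rightarrow> nat \<Rightarrow> 'a wgraph \<Rightarrow> 'a set set \<Rightarrow> bool" where
  "dp_output k \<rho> G S \<longleftrightarrow> (\<exists>T X.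
     (\<forall>s\<in>verts G. sp_tree \<rho> G s (T s) \<and> dp_choice k (T s) (X s)) \<and>
     S = (\<Union>s\<in>verts G. (\<lambda>u. {s, u}) ` X s))"

end

theory Submission imports Defs "HOL-Library.Multiset"
begin

text \<open>
  Take a path with \<open>k\<close> vertices and attach \<open>m\<close> leaves to each of its two ends, all weights being \<open>1\<close>,
  and let \<open>\<rho>\<close> be the number of all other vertices. The only pairs more than \<open>k\<close> hops apart are
  the \<open>m\<^sup>2\<close> pairs of leaves at opposite ends. A single shortcut between the ends of the path repairs all of them,
  while the greedy heuristic adds one shortcut per pair, and the dynamic program, working on
  each source separately, adds at least one shortcut at each of the \<open>2 * m\<close> leaves, hence at
  least \<open>m\<close> in total.
\<close>

section \<open>Paths\<close>

lemma path_edges_snoc: "p \<noteq> [] \<Longrightarrow> path_edges (p @ [v]) = path_edges p @ [{last p, v}]"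
  by (induction p rule: path_edges.induct) auto

lemma length_path_edges: "length (path_edges p) = length p - 1"
  by (induction p rule: path_edges.induct) auto

lemma paths_snoc:
  assumes "p \<in> paths G s u" "v \<in> verts G" "{u, v} \<in> edges G" "v \<notin> set p"
  shows "p @ [v] \<in> paths G s v"
  using assms by (auto simp: paths_def path_edges_snoc)

lemma path_weight_snoc:
  "p \<in> paths G s u \<Longrightarrow> path_weight G (p @ [v]) = path_weight G p + weight G {u, v}"
  by (auto simp: paths_def path_weight_def path_edges_snoc)

section \<open>Distances certified by a potential\<close>

text \<open>\<open>L\<close> is a certificate for the distances from \<open>s\<close>: the edge
  inequality makes it a lower bound for path weights, and the predecessor condition makes it
  attained. \<open>H\<close> only bounds from above the number of edges of some shortest path, which
  is enough to establish a ball.\<close>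

locale sp_levels =
  fixes G :: "'a wgraph" and s :: 'a and L :: "'a \<Rightarrow> real" and H :: "'a \<Rightarrow> nat"
  assumes source_in_verts: "s \<in> verts G"
    and level_source: "L s = 0"
    and level_edge: "\<And>u v. \<lbrakk>u \<in> verts G; v \<in> verts G; {u, v} \<in> edges G\<rbrakk>
      \<Longrightarrow> L v \<le> L u + weight G {u, v}"
    and level_pred: "\<And>v. \<lbrakk>v \<in> verts G; v \<noteq> s\<rbrakk> \<Longrightarrow>
      \<exists>u\<in>verts G. {u, v} \<in> edges G \<and> L v = L u + weight G {u, v} \<and> L u < L v \<and> H u < H v"
begin

lemma level_le_path_weight:
  assumes "p \<in> paths G s v"
  shows "L v \<le> path_weight G p"
proof -
  have "L (last p) \<le> L (hd p) + path_weight G p"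
    if "p \<noteq> []" "set p \<subseteq> verts G" "set (path_edges p) \<subseteq> edges G" for p
    using that
  proof (induction p rule: path_edges.induct)
    case (1 u v p)
    then show ?case using level_edge[of u v] by (auto simp: path_weight_def)
  qed (auto simp: path_weight_def)
  from this[of p] show ?thesis using assms level_source by (auto simp: paths_def)
qed

text \<open>Predecessors are followed back to \<open>s\<close>. The clause on \<open>L y\<close>
  keeps the path simple: everything on the path to \<open>u\<close> has level at most
  \<open>L u < L v\<close>, so \<open>v\<close> is new.\<close>

lemma level_path:
  "v \<in> verts G \<Longrightarrow> \<exists>p\<in>paths G s v. path_weight G p = L v \<and> length (path_edges p) \<le> H v
     \<and> (\<forall>y\<in>set p. L y \<le> L v)"
proof (induction "H v" arbitrary: v rule: less_induct)
  case less
  show ?case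
  proof (cases "v = s")
    case True
    then show ?thesis
      using source_in_verts level_source
      by (intro bexI[of _ "[s]"]) (auto simp: paths_def path_weight_def)
  next
    case False
    then obtain u where u: "u \<in> verts G" "{u, v} \<in> edges G" "L v = L u + weight G {u, v}"
      "L u < L v" "H u < H v"
      using level_pred less.prems by blast
    then obtain p where p: "p \<in> paths G s u" "path_weight G p = L u"
      "length (path_edges p) \<le> H u" "\<forall>y\<in>set p. L y \<le> L u"
      using less.hyps by blast
    then have "p @ [v] \<in> paths G s v"
      using u less.prems by (intro paths_snoc) force+
    moreover have "p \<noteq> []" using p by (auto simp: paths_def)
    ultimately show ?thesis using p u
      by (intro bexI[of _ "p @ [v]"]) (force simp: path_weight_snoc path_edges_snoc)+
  qed
qed

lemma gdist_eq:
  assumes "v \<in> verts G"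
  shows "gdist G s v = ereal (L v)"
  unfolding gdist_def
proof (rule antisym)
  obtain p where "p \<in> paths G s v" "path_weight G p = L v" using level_path assms by blast
  then show "(INF p\<in>paths G s v. ereal (path_weight G p)) \<le> ereal (L v)"
    by (intro INF_lower2[of p]) auto
  show "ereal (L v) \<le> (INF p\<in>paths G s v. ereal (path_weight G p))"
    by (intro INF_greatest) (simp add: level_le_path_weight)
qed

lemma hopdist_le:
  assumes "v \<in> verts G"
  shows "hopdist G s v \<le> enat (H v)"
proof -
  obtain p where "p \<in> paths G s v" "path_weight G p = L v" "length (path_edges p) \<le> H v"
    using level_path assms by blast
  then show ?thesis unfolding hopdist_def
    by (intro INF_lower2[of p]) (auto simp: gdist_eq[OF assms])
qed

lemma reachable_source: "reachable G s = verts G - {s}"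
  by (auto simp: reachable_def gdist_eq)

text \<open>All vertices other than \<open>s\<close> are reachable and their number is the parameter
  itself, so ties leave no choice.\<close>

lemma nearest_nbrs_all:
  assumes "finite (verts G)"
  shows "nearest_nbrs (card (verts G) - 1) G s N \<longleftrightarrow> N = verts G - {s}"
proof -
  have c: "card (verts G - {s}) = card (verts G) - 1"
    using assms source_in_verts by simp
  have f: "finite (verts G - {s})" using assms by blast
  show ?thesis
    using card_subset_eq[OF f] by (auto simp: nearest_nbrs_def reachable_source c)
qed

lemma near_radius_le:
  assumes "finite (verts G)" "\<And>v. v \<in> verts G \<Longrightarrow> L v \<le> r"
  shows "near_radius (card (verts G) - 1) G s \<le> ereal r"
proof -
  have "{v \<in> verts G - {s}. gdist G s v \<le> ereal r} = verts G - {s}"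
    using assms(2) by (auto simp: gdist_eq)
  then show ?thesis unfolding near_radius_def
    using assms(1) source_in_verts by (intro Inf_lower) simp
qed

text \<open>With every vertex within \<open>k\<close> hops, \<open>rbar\<close> is an infimum over
  the empty set, hence infinite, while the radius is finite.\<close>

lemma has_krho_ball_all:
  assumes "finite (verts G)" "\<And>v. v \<in> verts G \<Longrightarrow> H v \<le> k"
  shows "has_krho_ball k (card (verts G) - 1) G s"
proof -
  have "near_radius (card (verts G) - 1) G s \<le> ereal (Max (L ` verts G))"
    using assms(1) by (intro near_radius_le) auto
  then have "near_radius (card (verts G) - 1) G s < \<infinity>"
    using ereal_infty_less(1) le_less_trans by fastforce
  moreover have "{v \<in> verts G. hopdist G s v > enat k} = {}"
    using hopdist_le assms(2) by (force simp: not_less intro: order_trans)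
  then have "rbar k G s = \<infinity>"
    unfolding rbar_def by (metis Inf_empty image_empty top_ereal_def)
  ultimately show ?thesis by (simp add: has_krho_ball_def)
qed

end

text \<open>A ball that has to hold all other vertices has a radius at least the distance of each of
  them, so a vertex beyond \<open>k\<close> hops forces the radius up to \<open>rbar\<close> or
  more.\<close>

lemma has_krho_ball_all_imp_hopdist_le:
  assumes "finite (verts G)" "s \<in> verts G" "v \<in> verts G" "v \<noteq> s"
    and "has_krho_ball k (card (verts G) - 1) G s"
  shows "hopdist G s v \<le> enat k"
proof (rule ccontr)
  assume "\<not> hopdist G s v \<le> enat k"
  then have "rbar k G s \<le> gdist G s v"
    unfolding rbar_def using assms by (intro INF_lower) auto
  also have "\<dots> \<le> near_radius (card (verts G) - 1) G s"
    unfolding near_radius_def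
  proof (intro Inf_greatest, clarify)
    fix r assume r: "card (verts G) - 1 \<le> card {v \<in> verts G - {s}. gdist G s v \<le> r}"
    have "{v \<in> verts G - {s}. gdist G s v \<le> r} = verts G - {s}"
      using assms r by (intro card_seteq) auto
    then show "gdist G s v \<le> r" using assms by blast
  qed
  finally show False using assms(5) by (simp add: has_krho_ball_def)
qed

section \<open>Trees\<close>

lemma root_paths_nonempty: "p \<in> root_paths T \<Longrightarrow> p \<noteq> []"
  by (cases T) auto

lemma set_root_paths: "p \<in> root_paths T \<Longrightarrow> set p \<subseteq> set (preorder T)"
proof (induction T arbitrary: p)
  case (Node u cs)
  then show ?case by (fastforce simp: image_iff)
qed

lemma root_path_exists: "v \<in> set (preorder T) \<Longrightarrow> \<exists>p\<in>root_paths T. last p = v"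
proof (induction T)
  case (Node u cs)
  show ?case
  proof (cases "v = u")
    case False
    then obtain c where "c \<in> set cs" "v \<in> set (preorder c)"
      using Node.prems by auto
    moreover from this obtain p where "p \<in> root_paths c" "last p = v"
      using Node.IH by blast
    ultimately show ?thesis
      using root_paths_nonempty[of p c] by (intro bexI[of _ "u # p"]) auto
  qed auto
qed

section \<open>Growing a tree by one leaf\<close>

fun add_leaf :: "'a \<Rightarrow> 'a \<Rightarrow> 'a rtree \<Rightarrow> 'a rtree" where
  "add_leaf x y (Node u cs) = Node u ((if u = x then [Node y []] else []) @ map (add_leaf x y) cs)"

lemma root_add_leaf [simp]: "root (add_leaf x y T) = root T"
  by (cases T) auto

text \<open>The new leaf may land in the middle of the preorder list, so multisets are compared.
  Counting one \<open>y\<close> per occurrence of \<open>x\<close> is the form that passes through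
  the induction.\<close>

lemma mset_preorder_add_leaf:
  "mset (preorder (add_leaf x y T)) =
     mset (preorder T) + replicate_mset (count (mset (preorder T)) x) y"
proof (induction T)
  case (Node u cs)
  have "mset (concat (map (preorder \<circ> add_leaf x y) cs)) =
      mset (concat (map preorder cs)) + replicate_mset (count (mset (concat (map preorder cs))) x) y"
    using Node by (induction cs) (auto simp: multiset_eq_iff)
  then show ?case by (auto simp: multiset_eq_iff)
qed

lemma preorder_add_leaf:
  assumes "distinct (preorder T)" "x \<in> set (preorder T)" "y \<notin> set (preorder T)"
  shows "distinct (preorder (add_leaf x y T))"
    and "set (preorder (add_leaf x y T)) = insert y (set (preorder T))"
proof -
  have "mset (preorder (add_leaf x y T)) = mset (y # preorder T)"
    using assms by (simp add: mset_preorder_add_leaf distinct_count_atmost_1)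
  then show "distinct (preorder (add_leaf x y T))"
    and "set (preorder (add_leaf x y T)) = insert y (set (preorder T))"
    using assms by (metis mset_eq_imp_distinct_iff distinct.simps(2),
        metis mset_eq_setD list.simps(15))
qed

lemma root_paths_add_leaf:
  "root_paths (add_leaf x y T) = root_paths T \<union> (\<lambda>p. p @ [y]) ` {p \<in> root_paths T. last p = x}"
proof (induction T)
  case (Node u cs)
  \<comment> \<open>Prefixing \<open>u\<close> does not change the last vertex, because the root
    paths of the children are nonempty.\<close>
  have "{p \<in> root_paths (Node u cs). last p = x} =
      (if u = x then {[u]} else {}) \<union> (#) u ` (\<Union>c\<in>set cs. {p \<in> root_paths c. last p = x})"
    (is "?A = ?B")
  proof (intro equalityI subsetI)
    fix p assume "p \<in> ?A"
    then consider "p = [u]" "x = u" | q c where "p = u # q" "c \<in> set cs" "q \<in> root_paths c" "last p = x"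
      by auto
    then show "p \<in> ?B"
    proof cases
      case 1
      then show ?thesis by simp
    next
      case 2
      then have "last q = x" using root_paths_nonempty[of q c] by simp
      then show ?thesis using 2 by blast
    qed
  next
    fix p assume "p \<in> ?B"
    then show "p \<in> ?A" by (auto dest: root_paths_nonempty split: if_splits)
  qed
  then show ?case
    using Node.IH by (auto simp: image_iff)
qed

section \<open>The dynamic program\<close>

lemma sum_list_eq_infty_iff:
  "(\<Sum>x\<leftarrow>xs. f x) = (\<infinity> :: enat) \<longleftrightarrow> (\<exists>x\<in>set xs. f x = \<infinity>)"
proof (induction xs)
  case (Cons x xs)
  have "f x + (\<Sum>x\<leftarrow>xs. f x) = \<infinity> \<longleftrightarrow> f x = \<infinity> \<or> (\<Sum>x\<leftarrow>xs. f x) = \<infinity>"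
    by (rule plus_eq_infty_iff_enat)
  then show ?case using Cons.IH by simp
qed simp

text \<open>Taking the first option at every node restarts the children at depth 1, which is below
  \<open>k\<close> because \<open>k \<ge> 2\<close>.\<close>

lemma dp_F_finite:
  assumes "k \<ge> 2" "t < k"
  shows "dp_F k T t \<noteq> \<infinity>"
  using assms(2)
proof (induction T arbitrary: t)
  case (Node u cs)
  have "(\<Sum>w\<leftarrow>cs. dp_F k w 1) \<noteq> \<infinity>"
    using Node.IH assms(1) by (simp add: sum_list_eq_infty_iff)
  then have "1 + (\<Sum>w\<leftarrow>cs. dp_F k w 1) \<noteq> \<infinity>"
    by (simp add: one_enat_def plus_eq_infty_iff_enat)
  moreover have "dp_F k (Node u cs) t \<le> 1 + (\<Sum>w\<leftarrow>cs. dp_F k w 1)"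
    using Node.prems by simp
  ultimately show ?case by (metis enat_ord_simps(5))
qed

section \<open>Choice sets that attain the minimum of the recursion\<close>

lemma dp_cost_cong:
  "X \<inter> set (preorder T) = Y \<inter> set (preorder T) \<Longrightarrow> dp_cost k X T t = dp_cost k Y T t"
proof (induction T arbitrary: t)
  case (Node u cs)
  have "dp_cost k X w t' = dp_cost k Y w t'" if "w \<in> set cs" for w t'
    using that Node.prems by (intro Node.IH) auto
  then have "map (\<lambda>w. dp_cost k X w t') cs = map (\<lambda>w. dp_cost k Y w t') cs" for t'
    by auto
  moreover have "u \<in> X \<longleftrightarrow> u \<in> Y" using Node.prems by auto
  ultimately show ?case by (simp only: dp_cost.simps)
qed

text \<open>Distinct labels make the subtrees disjoint, and the cost of a subtree depends only on
  the labels chosen inside it, so optimal choices can be united. The first assumption is shaped to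
  accept the induction hypothesis of an induction over trees.\<close>

lemma forest_cost_attained:
  assumes "\<And>c. c \<in> set cs \<Longrightarrow> distinct (preorder c) \<Longrightarrow>
      \<exists>X\<subseteq>set (preorder c). dp_cost k X c t = dp_F k c t"
    and "distinct (concat (map preorder cs))"
  shows "\<exists>X\<subseteq>set (concat (map preorder cs)).
      (\<Sum>c\<leftarrow>cs. dp_cost k X c t) = (\<Sum>c\<leftarrow>cs. dp_F k c t)"
  using assms
proof (induction cs)
  case (Cons c cs)
  have d: "distinct (preorder c)" "distinct (concat (map preorder cs))"
    using Cons.prems(2) by simp_all
  obtain X where X: "X \<subseteq> set (preorder c)" "dp_cost k X c t = dp_F k c t"
    using Cons.prems(1)[OF _ d(1)] by (meson list.set_intros(1))
  obtain Y where Y: "Y \<subseteq> set (concat (map preorder cs))"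
    "(\<Sum>c\<leftarrow>cs. dp_cost k Y c t) = (\<Sum>c\<leftarrow>cs. dp_F k c t)"
    using Cons.IH[OF Cons.prems(1) d(2)] by (meson list.set_intros(2))
  have disj: "set (preorder c) \<inter> set (concat (map preorder cs)) = {}"
    using Cons.prems(2) by simp
  have "dp_cost k (X \<union> Y) c t = dp_cost k X c t"
    using X Y disj by (intro dp_cost_cong) blast
  moreover have "map (\<lambda>d. dp_cost k (X \<union> Y) d t) cs = map (\<lambda>d. dp_cost k Y d t) cs"
  proof (intro map_cong refl dp_cost_cong)
    fix d assume "d \<in> set cs"
    then have "set (preorder d) \<subseteq> set (concat (map preorder cs))" by auto
    then show "(X \<union> Y) \<inter> set (preorder d) = Y \<inter> set (preorder d)" using X disj by blast
  qed
  ultimately have "(\<Sum>c\<leftarrow>c # cs. dp_cost k (X \<union> Y) c t) = (\<Sum>c\<leftarrow>c # cs. dp_F k c t)"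
    using X Y by (simp cong: map_cong)
  then show ?case using X Y by (intro exI[of _ "X \<union> Y"]) auto
qed simp

text \<open>The set \<open>insert u X\<close> realizes the first option and \<open>Y\<close> the
  second. Since \<open>u\<close> does not occur among its descendants, adding it leaves the costs of
  the children unchanged.\<close>

lemma dp_cost_attained:
  "distinct (preorder T) \<Longrightarrow> \<exists>X\<subseteq>set (preorder T). dp_cost k X T t = dp_F k T t"
proof (induction T arbitrary: t)
  case (Node u cs)
  let ?P = "set (concat (map preorder cs))"
  have u: "u \<notin> ?P" and d: "distinct (concat (map preorder cs))" using Node.prems by auto
  obtain X where X: "X \<subseteq> ?P" "(\<Sum>c\<leftarrow>cs. dp_cost k X c 1) = (\<Sum>c\<leftarrow>cs. dp_F k c 1)"
    using forest_cost_attained[of cs k 1] Node.IH d by blast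
  obtain Y where Y: "Y \<subseteq> ?P" "(\<Sum>c\<leftarrow>cs. dp_cost k Y c (t + 1)) = (\<Sum>c\<leftarrow>cs. dp_F k c (t + 1))"
    using forest_cost_attained[of cs k "t + 1"] Node.IH d by blast
  have "dp_cost k (insert u X) c 1 = dp_cost k X c 1" if "c \<in> set cs" for c
    using that u by (intro dp_cost_cong) auto
  then have "map (\<lambda>c. dp_cost k (insert u X) c 1) cs = map (\<lambda>c. dp_cost k X c 1) cs" by simp
  then have 1: "dp_cost k (insert u X) (Node u cs) t = 1 + (\<Sum>c\<leftarrow>cs. dp_F k c 1)" if "t < k"
    using X that by (simp only: dp_cost.simps) simp
  have 2: "dp_cost k Y (Node u cs) t = (\<Sum>c\<leftarrow>cs. dp_F k c (t + 1))" if "t < k"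
    using Y u that by auto
  have sub: "insert u X \<subseteq> set (preorder (Node u cs))" "Y \<subseteq> set (preorder (Node u cs))"
    using X Y by auto
  consider "t \<ge> k" | "t < k" "dp_F k (Node u cs) t = 1 + (\<Sum>c\<leftarrow>cs. dp_F k c 1)"
    | "t < k" "dp_F k (Node u cs) t = (\<Sum>c\<leftarrow>cs. dp_F k c (t + 1))"
    by (metis dp_F.simps min_def not_le)
  then show ?case
  proof cases
    case 1
    then show ?thesis by (intro exI[of _ "{}"]) auto
  next
    case 2
    then show ?thesis using 1 sub by metis
  next
    case 3
    then show ?thesis using 2 sub by metis
  qed
qed

lemma dp_choice_exists:
  assumes "distinct (preorder T)"
  shows "\<exists>X. dp_choice k T X"
proof (cases T)
  case (Node s cs)
  then have "distinct (concat (map preorder cs))" using assms by simp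
  then obtain X where "X \<subseteq> set (concat (map preorder cs))"
    "(\<Sum>c\<leftarrow>cs. dp_cost k X c 0) = (\<Sum>c\<leftarrow>cs. dp_F k c 0)"
    using forest_cost_attained[of cs k 0] dp_cost_attained by blast
  then show ?thesis using Node assms by (intro exI[of _ X]) (auto simp: dp_choice_def)
qed

text \<open>Without shortcuts each tree edge raises the depth argument by one, so it is
  \<open>t + length p - 1 \<ge> k\<close> at the last node of \<open>p\<close> unless it reached
  \<open>k\<close> before. One infinite summand makes all enclosing sums infinite.\<close>

lemma dp_cost_no_shortcut:
  "p \<in> root_paths T \<Longrightarrow> t + length p > k \<Longrightarrow> dp_cost k {} T t = \<infinity>"
proof (induction T arbitrary: p t)
  case (Node u cs)
  show ?case
  proof (cases "t \<ge> k")
    case False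
    then obtain q c where "p = u # q" "c \<in> set cs" "q \<in> root_paths c"
      using Node.prems by auto
    moreover from this have "dp_cost k {} c (t + 1) = \<infinity>"
      using Node.IH[of c q "t + 1"] Node.prems by simp
    ultimately have "(\<Sum>w\<leftarrow>cs. dp_cost k {} w (t + 1)) = \<infinity>"
      unfolding sum_list_eq_infty_iff by blast
    then show ?thesis using False by simp
  qed simp
qed

text \<open>The empty choice costs infinity while the minimum is finite. As \<open>length\<close>
  counts vertices, \<open>p\<close> has more than \<open>k\<close> edges.\<close>

lemma dp_choice_nonempty:
  assumes "dp_choice k T X" "k \<ge> 2" "p \<in> root_paths T" "length p > k + 1"
  shows "X \<noteq> {}"
proof
  assume "X = {}"
  obtain s cs where T: "T = Node s cs" by (cases T)
  obtain q c where "p = s # q" "c \<in> set cs" "q \<in> root_paths c"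
    using assms T by auto
  moreover from this have "dp_cost k {} c 0 = \<infinity>"
    using dp_cost_no_shortcut[of q c k 0] assms by simp
  ultimately have "(\<Sum>w\<leftarrow>cs. dp_cost k {} w 0) = \<infinity>"
    unfolding sum_list_eq_infty_iff by blast
  moreover have k0: "0 < k" using assms(2) by simp
  have "(\<Sum>w\<leftarrow>cs. dp_F k w 0) \<noteq> \<infinity>"
    unfolding sum_list_eq_infty_iff using dp_F_finite[OF assms(2), of 0] k0 by blast
  ultimately show False using assms(1) T \<open>X = {}\<close> by (simp add: dp_choice_def)
qed

section \<open>Unit weights\<close>

text \<open>With unit weights the weight of a path is its number of edges, so a single function
  \<open>D\<close> serves as potential and as hop bound, and the hop bound becomes exact.\<close>

locale unit_levels =
  fixes G :: "'a wgraph" and s :: 'a and D :: "'a \<Rightarrow> nat"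
  assumes finite_verts: "finite (verts G)"
    and unit_weight: "\<And>e. weight G e = 1"
    and source: "s \<in> verts G"
    and dist_source: "D s = 0"
    and dist_edge: "\<And>u v. \<lbrakk>u \<in> verts G; v \<in> verts G; {u, v} \<in> edges G\<rbrakk> \<Longrightarrow> D v \<le> Suc (D u)"
    and dist_pred: "\<And>v. \<lbrakk>v \<in> verts G; v \<noteq> s\<rbrakk> \<Longrightarrow>
      \<exists>u\<in>verts G. {u, v} \<in> edges G \<and> D v = Suc (D u)"
begin

sublocale sp_levels G s "\<lambda>v. real (D v)" D
proof
  fix u v assume "u \<in> verts G" "v \<in> verts G" "{u, v} \<in> edges G"
  then show "real (D v) \<le> real (D u) + weight G {u, v}"
    using dist_edge[of u v] by (simp add: unit_weight)
next
  fix v assume "v \<in> verts G" "v \<noteq> s"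
  then show "\<exists>u\<in>verts G. {u, v} \<in> edges G \<and> real (D v) = real (D u) + weight G {u, v} \<and>
      real (D u) < real (D v) \<and> D u < D v"
    using dist_pred[of v] by (auto simp: unit_weight)
qed (simp_all add: source dist_source)

lemma path_weight_unit: "path_weight G p = real (length (path_edges p))"
  by (simp add: path_weight_def unit_weight sum_list_triv)

lemma hopdist_eq:
  assumes "v \<in> verts G"
  shows "hopdist G s v = enat (D v)"
proof (rule antisym)
  show "hopdist G s v \<le> enat (D v)" by (rule hopdist_le[OF assms])
  show "enat (D v) \<le> hopdist G s v" unfolding hopdist_def
    by (intro INF_greatest) (auto simp: gdist_eq[OF assms] path_weight_unit)
qed

text \<open>The tree grows as in breadth-first search, always by a missing vertex of least
  \<open>D\<close>; \<open>i\<close> counts the vertices added to the root.\<close>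

lemma partial_sp_tree:
  "i < card (verts G) \<Longrightarrow> \<exists>T. root T = s \<and> distinct (preorder T) \<and> set (preorder T) \<subseteq> verts G \<and>
     card (set (preorder T)) = Suc i \<and>
     (\<forall>p\<in>root_paths T. p \<in> paths G s (last p) \<and> length (path_edges p) = D (last p))"
proof (induction i)
  case 0
  then show ?case
    by (intro exI[of _ "Node s []"]) (auto simp: source dist_source paths_def)
next
  case (Suc i)
  then obtain T where T: "root T = s" "distinct (preorder T)" "set (preorder T) \<subseteq> verts G"
    "card (set (preorder T)) = Suc i"
    "\<And>p. p \<in> root_paths T \<Longrightarrow> p \<in> paths G s (last p) \<and> length (path_edges p) = D (last p)"
    by (meson Suc_lessD)
  have "verts G - set (preorder T) \<noteq> {}"
    using T Suc.prems finite_verts by (metis Diff_eq_empty_iff card_mono finite_set not_le)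
  then obtain v where v: "v \<in> verts G - set (preorder T)"
    "\<And>y. y \<in> verts G - set (preorder T) \<Longrightarrow> D v \<le> D y"
    using ex_has_least_nat[of "\<lambda>v. v \<in> verts G - set (preorder T)" _ D] by blast
  have s: "s \<in> set (preorder T)" using T(1) by (cases T) auto
  then obtain u where u: "u \<in> verts G" "{u, v} \<in> edges G" "D v = Suc (D u)"
    using dist_pred[of v] v by blast
  \<comment> \<open>A missing \<open>u\<close> would contradict the minimality of \<open>v\<close>,
    since \<open>D u < D v\<close>.\<close>
  then have uT: "u \<in> set (preorder T)" using v(2)[of u] by auto
  let ?T = "add_leaf u v T"
  have "q \<in> paths G s (last q) \<and> length (path_edges q) = D (last q)"
    if q: "q \<in> root_paths ?T" for q
  proof (cases "q \<in> root_paths T")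
    case True
    then show ?thesis by (rule T(5))
  next
    case False
    then obtain p where p: "q = p @ [v]" "p \<in> root_paths T" "last p = u"
      using q by (auto simp: root_paths_add_leaf)
    moreover have "v \<notin> set p" using set_root_paths[OF p(2)] v by blast
    ultimately show ?thesis
      using T(5)[OF p(2)] u v(1) root_paths_nonempty[OF p(2)] paths_snoc[of p G s u v]
      by (auto simp: path_edges_snoc)
  qed
  moreover note preorder_add_leaf[OF T(2) uT, of v]
  ultimately show ?case
    using T(1,3,4) v(1) by (intro exI[of _ ?T]) auto
qed

lemma sp_tree_exists: "\<exists>T. sp_tree (card (verts G) - 1) G s T"
proof -
  have "card (verts G) > 0" using finite_verts source by (auto simp: card_gt_0_iff)
  then obtain T where T: "root T = s" "distinct (preorder T)" "set (preorder T) \<subseteq> verts G"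
    "card (set (preorder T)) = card (verts G)"
    "\<And>p. p \<in> root_paths T \<Longrightarrow> p \<in> paths G s (last p) \<and> length (path_edges p) = D (last p)"
    using partial_sp_tree[of "card (verts G) - 1"] by auto
  have "set (preorder T) = verts G" using T(3,4) finite_verts by (intro card_subset_eq)
  moreover from this have "nearest_nbrs (card (verts G) - 1) G s (set (preorder T) - {s})"
    by (simp only: nearest_nbrs_all[OF finite_verts])
  moreover have "last p \<in> verts G" if "p \<in> root_paths T" for p
    using T(5)[OF that] by (auto simp: paths_def)
  ultimately show ?thesis
    using T(1,2,5)
    by (intro exI[of _ T])
       (auto simp: sp_tree_def gdist_eq hopdist_eq path_weight_unit)
qed

lemma sp_tree_choice_nonempty:
  assumes "sp_tree (card (verts G) - 1) G s T" "dp_choice k T X" "k \<ge> 2"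
    and "v \<in> verts G" "D v > k"
  shows "X \<noteq> {}"
proof -
  have "v \<noteq> s" using assms(5) dist_source by auto
  moreover have "set (preorder T) - {s} = verts G - {s}"
    using assms(1) unfolding sp_tree_def nearest_nbrs_all[OF finite_verts] by blast
  ultimately have "v \<in> set (preorder T)" using assms(4) by blast
  then obtain p where p: "p \<in> root_paths T" "last p = v" using root_path_exists by metis
  then have "length (path_edges p) = D v"
    using assms(1,4) unfolding sp_tree_def by (metis enat.inject hopdist_eq)
  then have "length p > k + 1" using assms(5) by (simp add: length_path_edges)
  then show ?thesis using dp_choice_nonempty assms p by metis
qed

end

section \<open>The double broom\<close>

definition broom_verts :: "nat \<Rightarrow> nat \<Rightarrow> nat set" where
  "broom_verts k m = {..<k + 2 * m}"

text \<open>
  The path consists of the vertices below \<open>k\<close>, at positions \<open>1\<close> to \<open>k\<close>; the leaves at its two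
  ends get the positions \<open>0\<close> and \<open>k + 1\<close>.
\<close>

definition broom_pos :: "nat \<Rightarrow> nat \<Rightarrow> nat \<Rightarrow> nat" where
  "broom_pos k m v = (if v < k then Suc v else if v < k + m then 0 else Suc k)"

text \<open>For \<open>k \<ge> 1\<close> each of the positions \<open>1\<close> to \<open>k\<close>
  is held by a single vertex, so joining consecutive positions yields the path with the leaves
  attached to its ends.\<close>

definition broom :: "nat \<Rightarrow> nat \<Rightarrow> nat wgraph" where
  "broom k m = \<lparr>verts = broom_verts k m,
     edges = {{u, v} | u v. u \<in> broom_verts k m \<and> v \<in> broom_verts k m \<and>
       broom_pos k m v = Suc (broom_pos k m u)},
     weight = (\<lambda>_. 1)\<rparr>"

text \<open>Distinct vertices at the same position are leaves at the same end, hence the \<open>2\<close>.\<close>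

definition broom_dist :: "nat \<Rightarrow> nat \<Rightarrow> nat \<Rightarrow> nat \<Rightarrow> nat" where
  "broom_dist k m s v =
     (if v = s then 0 else if broom_pos k m s = broom_pos k m v then 2
      else (broom_pos k m s - broom_pos k m v) + (broom_pos k m v - broom_pos k m s))"

lemma broom_edge_iff:
  "{u, v} \<in> edges (broom k m) \<longleftrightarrow> u \<in> broom_verts k m \<and> v \<in> broom_verts k m \<and>
     (broom_pos k m v = Suc (broom_pos k m u) \<or> broom_pos k m u = Suc (broom_pos k m v))"
  by (auto simp: broom_def doubleton_eq_iff)

lemma verts_broom [simp]: "verts (broom k m) = broom_verts k m"
  and weight_broom [simp]: "weight (broom k m) e = 1"
  by (simp_all add: broom_def)

lemma finite_broom_verts [simp]: "finite (broom_verts k m)"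
  by (simp add: broom_verts_def)

lemma broom_dist_edge:
  assumes "{u, v} \<in> edges (broom k m)"
  shows "broom_dist k m s v \<le> Suc (broom_dist k m s u)"
proof -
  define a b c where abc: "a = broom_pos k m s" "b = broom_pos k m u" "c = broom_pos k m v"
  have adj: "c = Suc b \<or> b = Suc c"
    using assms by (simp only: broom_edge_iff abc)
  have "u = s \<Longrightarrow> b = a" by (simp add: abc)
  \<comment> \<open>Truncated differences add up to the absolute difference, which changes by at
    most one along an edge. The second fact covers the value \<open>2\<close>: if \<open>v\<close>
    is at the position of \<open>s\<close>, then \<open>u\<close> is at another position.\<close>
  then have "(a - c) + (c - a) \<le> Suc (broom_dist k m s u)" "a = c \<Longrightarrow> 1 \<le> broom_dist k m s u"
    unfolding broom_dist_def abc(1,2)[symmetric] using adj by (cases "u = s"; cases "a = b"; force)+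
  then show ?thesis
    unfolding broom_dist_def[of k m s v] abc(1,3)[symmetric] by auto
qed

lemma broom_pos_le: "broom_pos k m v \<le> Suc k"
  by (simp add: broom_pos_def)

lemma broom_pos_inj:
  "\<lbrakk>broom_pos k m u = broom_pos k m v; 1 \<le> broom_pos k m u; broom_pos k m u \<le> k\<rbrakk> \<Longrightarrow> u = v"
  by (auto simp: broom_pos_def split: if_splits)

lemma broom_pos_spine: "i < k \<Longrightarrow> broom_pos k m i = Suc i"
  by (simp add: broom_pos_def)

text \<open>A path vertex is alone at its position, so the exceptional value \<open>2\<close> cannot
  occur and \<open>s = u\<close> fits the formula as well.\<close>

lemma broom_dist_spine:
  assumes "1 \<le> broom_pos k m u" "broom_pos k m u \<le> k"
  shows "broom_dist k m s u =
    (broom_pos k m s - broom_pos k m u) + (broom_pos k m u - broom_pos k m s)"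
  using assms broom_pos_inj[of k m u s] by (auto simp: broom_dist_def)

lemma broom_dist_pred:
  assumes "k \<ge> 1" "s \<in> broom_verts k m" "v \<in> broom_verts k m" "v \<noteq> s"
  shows "\<exists>u\<in>broom_verts k m. {u, v} \<in> edges (broom k m) \<and>
    broom_dist k m s v = Suc (broom_dist k m s u)"
proof -
  let ?p = "broom_pos k m"
  \<comment> \<open>The position of the predecessor: one step from \<open>v\<close> towards
    \<open>s\<close>, or the attachment vertex when both are leaves at the same end.\<close>
  define i where "i =
    (if ?p s = ?p v then (if ?p v = 0 then 1 else k)
     else if ?p s < ?p v then ?p v - 1 else ?p v + 1)"
  have le: "?p s \<le> Suc k" "?p v \<le> Suc k" by (rule broom_pos_le)+
  have leaf: "?p v = 0 \<or> ?p v = Suc k" if "?p s = ?p v"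
    using broom_pos_inj[of k m v s] that le assms(4) by force
  have near: "?p v = Suc i \<or> i = Suc (?p v)"
    using leaf by (auto simp: i_def)
  have dist_v: "broom_dist k m s v = Suc ((?p s - i) + (i - ?p s))"
    using leaf assms(1,4) by (auto simp: i_def broom_dist_def)
  have "\<exists>u\<in>broom_verts k m. ?p u = i \<and> broom_dist k m s u = (?p s - i) + (i - ?p s)"
  proof (cases "1 \<le> i \<and> i \<le> k")
    case True
    then have "?p (i - 1) = i" using broom_pos_spine[of "i - 1" k m] by auto
    moreover have "i - 1 \<in> broom_verts k m" using True by (auto simp: broom_verts_def)
    ultimately show ?thesis using True broom_dist_spine[of k m "i - 1" s] by auto
  next
    case False
    \<comment> \<open>Here \<open>i\<close> is a leaf position. The predecessor must be
      \<open>s\<close> itself, as any other leaf there is at distance \<open>2\<close> from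
      \<open>s\<close>.\<close>
    then have "i = ?p s" using le assms(1) by (auto simp: i_def split: if_splits)
    then show ?thesis using assms(2) by (auto simp: broom_dist_def)
  qed
  then show ?thesis using near dist_v assms(3) by (auto simp: broom_edge_iff)
qed

lemma unit_levels_broom:
  assumes "k \<ge> 1" "s \<in> broom_verts k m"
  shows "unit_levels (broom k m) s (broom_dist k m s)"
  using assms broom_dist_edge[of _ _ k m s] broom_dist_pred[OF assms]
  by unfold_locales (simp_all add: broom_dist_def[of k m s s])

lemma wf_broom: "wf_wgraph (broom k m)"
proof -
  have "\<exists>u\<in>broom_verts k m. \<exists>v\<in>broom_verts k m. u \<noteq> v \<and> e = {u, v}"
    if "e \<in> edges (broom k m)" for e
  proof -
    obtain u v where uv: "e = {u, v}" "u \<in> broom_verts k m" "v \<in> broom_verts k m"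
      "broom_pos k m v = Suc (broom_pos k m u)"
      using \<open>e \<in> edges (broom k m)\<close> by (auto simp: broom_def)
    moreover from this(4) have "u \<noteq> v" by (metis n_not_Suc_n)
    ultimately show ?thesis by blast
  qed
  then show ?thesis by (simp add: wf_wgraph_def)
qed

section \<open>Leaves at opposite ends\<close>

definition left_leaves :: "nat \<Rightarrow> nat \<Rightarrow> nat set" where
  "left_leaves k m = {k..<k + m}"

definition right_leaves :: "nat \<Rightarrow> nat \<Rightarrow> nat set" where
  "right_leaves k m = {k + m..<k + 2 * m}"

lemma leaves_subset:
  "left_leaves k m \<subseteq> broom_verts k m" "right_leaves k m \<subseteq> broom_verts k m"
  by (auto simp: left_leaves_def right_leaves_def broom_verts_def)

lemma broom_dist_leaves:
  assumes "a \<in> left_leaves k m" "b \<in> right_leaves k m"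
  shows "broom_dist k m a b = Suc k" "broom_dist k m b a = Suc k"
  using assms by (auto simp: left_leaves_def right_leaves_def broom_dist_def broom_pos_def)

subsection \<open>The optimum\<close>

text \<open>The path is numbered from \<open>0\<close> to \<open>k - 1\<close>, so the shortcut
  joins its two ends.\<close>

definition broom_opt :: "nat \<Rightarrow> nat \<Rightarrow> nat wgraph" where
  "broom_opt k m = add_shortcuts (broom k m) {{0, k - 1}}"

lemma gdist_broom:
  assumes "k \<ge> 1" "u \<in> broom_verts k m" "v \<in> broom_verts k m"
  shows "gdist (broom k m) u v = ereal (real (broom_dist k m u v))"
proof -
  interpret unit_levels "broom k m" u "broom_dist k m u"
    using unit_levels_broom assms by blast
  show ?thesis using gdist_eq assms by simp
qed

lemma hopdist_broom:
  assumes "k \<ge> 1" "u \<in> broom_verts k m" "v \<in> broom_verts k m"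
  shows "hopdist (broom k m) u v = enat (broom_dist k m u v)"
proof -
  interpret unit_levels "broom k m" u "broom_dist k m u"
    using unit_levels_broom assms by blast
  show ?thesis using hopdist_eq assms by simp
qed

lemma broom_dist_hub:
  assumes "k \<ge> 1"
  shows "broom_dist k m s 0 = (broom_pos k m s - 1) + (1 - broom_pos k m s)"
    and "broom_dist k m s (k - 1) = (broom_pos k m s - k) + (k - broom_pos k m s)"
  using broom_dist_spine[of k m 0 s] broom_dist_spine[of k m "k - 1" s] assms
  by (simp_all add: broom_pos_spine)

lemma broom_dist_hubs:
  assumes "k \<ge> 1"
  shows "broom_dist k m 0 (k - 1) = k - 1" "broom_dist k m (k - 1) 0 = k - 1"
  using assms by (simp_all add: broom_dist_hub[OF assms] broom_pos_spine del: One_nat_def)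

lemma hubs_in_broom_verts: "k \<ge> 1 \<Longrightarrow> 0 \<in> broom_verts k m \<and> k - 1 \<in> broom_verts k m"
  by (auto simp: broom_verts_def)

lemma broom_opt_simps:
  assumes "k \<ge> 1"
  shows "verts (broom_opt k m) = broom_verts k m"
    and "edges (broom_opt k m) = insert {0, k - 1} (edges (broom k m))"
    and "weight (broom_opt k m) e = (if e = {0, k - 1} then real (k - 1) else 1)"
proof -
  \<comment> \<open>The unordered pair admits both orientations; the description is unique because
    both give the distance \<open>k - 1\<close>.\<close>
  have "(THE r. \<exists>u v. {0, k - 1} = {u, v} \<and> gdist (broom k m) u v = ereal r) = real (k - 1)"
    using gdist_broom[OF assms, of 0 m "k - 1"] gdist_broom[OF assms, of "k - 1" m 0]
      broom_dist_hubs[OF assms, of m] hubs_in_broom_verts[OF assms, of m]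
    by (intro the_equality) (auto simp: doubleton_eq_iff)
  then show "weight (broom_opt k m) e = (if e = {0, k - 1} then real (k - 1) else 1)"
    by (simp add: broom_opt_def add_shortcuts_def)
qed (auto simp: broom_opt_def add_shortcuts_def)

text \<open>Between an end of the path or a leaf attached to it and the same region at the other
  end, the shortcut replaces the \<open>k - 1\<close> path edges by one edge and saves
  \<open>k - 2\<close> hops. For all other pairs the old distance is kept as the bound.\<close>

definition broom_opt_hops :: "nat \<Rightarrow> nat \<Rightarrow> nat \<Rightarrow> nat \<Rightarrow> nat" where
  "broom_opt_hops k m s v =
     (if broom_pos k m s \<le> 1 \<and> broom_pos k m v \<ge> k \<or> broom_pos k m s \<ge> k \<and> broom_pos k m v \<le> 1
      then broom_dist k m s v - (k - 2) else broom_dist k m s v)"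

text \<open>This is where \<open>k \<ge> 3\<close> enters: leaves at opposite ends get the bound
  \<open>k + 1 - (k - 2) = 3\<close>.\<close>

lemma broom_opt_hops_le:
  "k \<ge> 3 \<Longrightarrow> broom_opt_hops k m s v \<le> k"
  by (auto simp: broom_opt_hops_def broom_dist_def broom_pos_def)

text \<open>If \<open>v\<close> is the end of the path reached by crossing the shortcut, its
  predecessor is the other end; otherwise the predecessor in the broom still works. Distances stay
  as they were, since the shortcut weighs \<open>k - 1\<close>.\<close>

lemma broom_opt_pred:
  assumes "k \<ge> 3" "s \<in> broom_verts k m" "v \<in> broom_verts k m" "v \<noteq> s"
  shows "\<exists>u\<in>broom_verts k m. {u, v} \<in> edges (broom_opt k m) \<and>
    real (broom_dist k m s v) = real (broom_dist k m s u) + weight (broom_opt k m) {u, v} \<and>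
    real (broom_dist k m s u) < real (broom_dist k m s v) \<and>
    broom_opt_hops k m s u < broom_opt_hops k m s v"
proof -
  let ?p = "broom_pos k m"
  have k1: "k \<ge> 1" using assms by simp
  have hubs: "?p 0 = 1" "?p (k - 1) = k" using k1 by (simp_all add: broom_pos_spine)
  note dist_hubs = broom_dist_hub[OF k1, of m s]
  consider (lr) "?p s \<le> 1" "v = k - 1" | (rl) "?p s \<ge> k" "v = 0"
    | (other) "\<not> (?p s \<le> 1 \<and> v = k - 1)" "\<not> (?p s \<ge> k \<and> v = 0)"
    by blast
  then show ?thesis
  proof cases
    case lr
    then have "broom_dist k m s v = broom_dist k m s 0 + (k - 1)"
      using dist_hubs assms(1) by auto
    moreover from this have "broom_opt_hops k m s 0 < broom_opt_hops k m s v"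
      using lr hubs assms(1) by (simp add: broom_opt_hops_def)
    ultimately show ?thesis
      using lr assms hubs_in_broom_verts[OF k1]
      by (intro bexI[of _ 0]) (auto simp: broom_opt_simps[OF k1])
  next
    case rl
    then have "broom_dist k m s v = broom_dist k m s (k - 1) + (k - 1)"
      using dist_hubs assms(1) by auto
    moreover from this have "broom_opt_hops k m s (k - 1) < broom_opt_hops k m s v"
      using rl hubs assms(1) by (simp add: broom_opt_hops_def)
    ultimately show ?thesis
      using rl assms hubs_in_broom_verts[OF k1]
      by (intro bexI[of _ "k - 1"]) (auto simp: broom_opt_simps[OF k1] insert_commute)
  next
    case other
    obtain u where u: "u \<in> broom_verts k m" "{u, v} \<in> edges (broom k m)"
      "broom_dist k m s v = Suc (broom_dist k m s u)"
      using broom_dist_pred[OF k1 assms(2-4)] by blast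
    have adj: "?p v = Suc (?p u) \<or> ?p u = Suc (?p v)" using u(2) by (simp add: broom_edge_iff)
    have "{u, v} \<noteq> {0, k - 1}"
    proof
      assume "{u, v} = {0, k - 1}"
      then have "?p u = 1 \<and> ?p v = k \<or> ?p u = k \<and> ?p v = 1"
        using hubs by (metis doubleton_eq_iff)
      then show False using adj assms(1) by linarith
    qed
    moreover have "broom_opt_hops k m s u < broom_opt_hops k m s v"
    proof -
      let ?far = "\<lambda>x. ?p s \<le> 1 \<and> ?p x \<ge> k \<or> ?p s \<ge> k \<and> ?p x \<le> 1"
      \<comment> \<open>The bound could fail to increase only if the saving applied to
        \<open>v\<close> but not to \<open>u\<close>. With the ends of the path excluded, a far
        \<open>v\<close> is a leaf and \<open>u\<close> the end it hangs on, which is far too. The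
        distance bound keeps the truncated subtraction of \<open>k - 2\<close> strictly
        monotone.\<close>
      have "?far u \<and> broom_dist k m s u \<ge> k - 1" if far: "?far v"
      proof -
        have "?p s \<le> 1 \<Longrightarrow> ?p v \<noteq> k" "?p s \<ge> k \<Longrightarrow> ?p v \<noteq> 1"
          using other broom_pos_inj[of k m v "k - 1"] broom_pos_inj[of k m v 0] hubs k1 by auto
        then have "?far u \<and> (?p u = 1 \<or> ?p u = k)"
          using far adj broom_pos_le[of k m v] broom_pos_le[of k m u] assms(1) by auto
        then show ?thesis using broom_dist_spine[of k m u s] assms(1) by auto
      qed
      then show ?thesis using u(3) assms(1) by (auto simp: broom_opt_hops_def)
    qed
    moreover from calculation have "weight (broom_opt k m) {u, v} = 1"
      by (simp only: broom_opt_simps(3)[OF k1] if_False)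
    ultimately show ?thesis
      using u by (intro bexI[of _ u]) (simp_all add: broom_opt_simps(2)[OF k1])
  qed
qed

text \<open>The distances from \<open>s\<close> to the two ends of the path differ by at most
  \<open>k - 1\<close>, the weight of the shortcut, so the old distances remain a potential.\<close>

lemma broom_opt_dist_edge:
  assumes "k \<ge> 1" "{u, v} \<in> edges (broom_opt k m)"
  shows "real (broom_dist k m s v) \<le> real (broom_dist k m s u) + weight (broom_opt k m) {u, v}"
proof (cases "{u, v} = {0, k - 1}")
  case True
  have dist: "broom_dist k m s 0 \<le> broom_dist k m s (k - 1) + (k - 1)"
    "broom_dist k m s (k - 1) \<le> broom_dist k m s 0 + (k - 1)"
    unfolding broom_dist_hub[OF assms(1)] using assms(1) by arith+
  from True have "u = 0 \<and> v = k - 1 \<or> u = k - 1 \<and> v = 0"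
    by (simp only: doubleton_eq_iff)
  then have "broom_dist k m s v \<le> broom_dist k m s u + (k - 1)"
  proof (elim disjE conjE)
    assume "u = 0" "v = k - 1"
    show ?thesis unfolding \<open>u = 0\<close> \<open>v = k - 1\<close> by (rule dist)
  next
    assume "u = k - 1" "v = 0"
    show ?thesis unfolding \<open>u = k - 1\<close> \<open>v = 0\<close> by (rule dist)
  qed
  then have "real (broom_dist k m s v) \<le> real (broom_dist k m s u + (k - 1))"
    by (rule of_nat_mono)
  also have "\<dots> = real (broom_dist k m s u) + weight (broom_opt k m) {u, v}"
    unfolding of_nat_add broom_opt_simps(3)[OF assms(1)] if_P[OF True] by (rule refl)
  finally show ?thesis .
next
  case False
  then have "{u, v} \<in> edges (broom k m)"
    using assms(2) unfolding broom_opt_simps(2)[OF assms(1)] by (metis insertE)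
  moreover have "weight (broom_opt k m) {u, v} = 1"
    using False by (simp only: broom_opt_simps(3)[OF assms(1)] if_False)
  ultimately show ?thesis using broom_dist_edge[of u v k m s] by simp
qed

lemma sp_levels_broom_opt:
  assumes "k \<ge> 3" "s \<in> broom_verts k m"
  shows "sp_levels (broom_opt k m) s (\<lambda>v. real (broom_dist k m s v)) (broom_opt_hops k m s)"
proof -
  have k1: "k \<ge> 1" using assms by simp
  show ?thesis
    using assms(2) broom_opt_pred[OF assms] broom_opt_dist_edge[OF k1, of _ _ m s]
    by unfold_locales (simp_all add: broom_opt_simps(1)[OF k1] broom_dist_def[of k m s s])
qed

lemma msp_feasible_broom_opt:
  assumes "k \<ge> 3"
  shows "msp_feasible k (card (broom_verts k m) - 1) (broom k m) {{0, k - 1}}"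
proof -
  have k1: "k \<ge> 1" using assms by simp
  have "is_shortcut (broom k m) {0, k - 1}"
    unfolding is_shortcut_def
  proof (rule bexI[of _ 0], rule bexI[of _ "k - 1"], intro conjI)
    show hubs: "0 \<in> verts (broom k m)" "k - 1 \<in> verts (broom k m)"
      using hubs_in_broom_verts[OF k1] by simp_all
    show "0 \<noteq> k - 1" using assms by simp
    show "gdist (broom k m) 0 (k - 1) < \<infinity>"
      using gdist_broom[OF k1] hubs by simp
    show "1 < hopdist (broom k m) 0 (k - 1)"
      using hopdist_broom[OF k1] hubs broom_dist_hubs(1)[OF k1, of m] assms
      by (simp add: one_enat_def)
  qed simp
  moreover have "has_krho_ball k (card (broom_verts k m) - 1) (broom_opt k m) s"
    if "s \<in> broom_verts k m" for s
  proof -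
    interpret sp_levels "broom_opt k m" s "\<lambda>v. real (broom_dist k m s v)" "broom_opt_hops k m s"
      using sp_levels_broom_opt assms that by blast
    show ?thesis
      using has_krho_ball_all[of k] broom_opt_hops_le[OF assms] by (simp add: broom_opt_simps[OF k1])
  qed
  ultimately show ?thesis
    unfolding msp_feasible_def krho_graph_def broom_opt_def[symmetric] broom_opt_simps(1)[OF k1]
    by blast
qed

lemma add_no_shortcuts: "add_shortcuts G {} = G"
  by (simp add: add_shortcuts_def)

text \<open>The empty set fails because leaves at opposite ends are \<open>k + 1\<close> hops apart.
  Finiteness matters because \<open>card\<close> of an infinite set is \<open>0\<close>.\<close>

lemma msp_feasible_broom_card:
  assumes "k \<ge> 1" "m \<ge> 1" "msp_feasible k (card (broom_verts k m) - 1) (broom k m) S"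
  shows "card S \<ge> 1"
proof -
  have "S \<subseteq> Pow (broom_verts k m)"
    using assms(3) by (auto simp: msp_feasible_def is_shortcut_def)
  then have "finite S" by (rule finite_subset) simp
  moreover have "S \<noteq> {}"
  proof
    assume "S = {}"
    obtain a b where ab: "a \<in> left_leaves k m" "b \<in> right_leaves k m"
      using assms(2) by (fastforce simp: left_leaves_def right_leaves_def)
    then have ab': "a \<in> broom_verts k m" "b \<in> broom_verts k m" using leaves_subset by blast+
    have "has_krho_ball k (card (broom_verts k m) - 1) (broom k m) a"
      using assms(3) ab' \<open>S = {}\<close> by (auto simp: msp_feasible_def add_no_shortcuts krho_graph_def)
    moreover have "b \<noteq> a" using broom_dist_leaves[OF ab] by (auto simp: broom_dist_def)
    ultimately have "hopdist (broom k m) a b \<le> enat k"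
      using has_krho_ball_all_imp_hopdist_le[of "broom k m" a b k] ab' by simp
    then show False using ab' broom_dist_leaves[OF ab] assms(1) by (simp add: hopdist_broom)
  qed
  ultimately show ?thesis by (simp add: Suc_le_eq card_gt_0_iff)
qed

lemma msp_opt_broom:
  assumes "k \<ge> 3" "m \<ge> 1"
  shows "msp_opt k (card (broom_verts k m) - 1) (broom k m) = 1"
proof -
  let ?C = "card ` {S. msp_feasible k (card (broom_verts k m) - 1) (broom k m) S}"
  have "1 \<in> ?C" using msp_feasible_broom_opt[OF assms(1)] by (force simp: image_iff)
  moreover have "c \<ge> 1" if "c \<in> ?C" for c
    using that msp_feasible_broom_card[of k m] assms by auto
  ultimately show ?thesis unfolding msp_opt_def by (intro cInf_eq_minimum)
qed

subsection \<open>The heuristics\<close>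

lemma nearest_nbrs_broom:
  assumes "k \<ge> 1" "u \<in> broom_verts k m"
  shows "nearest_nbrs (card (broom_verts k m) - 1) (broom k m) u N \<longleftrightarrow> N = broom_verts k m - {u}"
proof -
  interpret unit_levels "broom k m" u "broom_dist k m u"
    using unit_levels_broom assms by blast
  show ?thesis using nearest_nbrs_all by simp
qed

section \<open>Greedy shortcuts on the broom\<close>

lemma greedy_output_broom_exists:
  assumes "k \<ge> 1"
  shows "\<exists>S. greedy_output k (card (broom_verts k m) - 1) (broom k m) S"
  unfolding greedy_output_def using nearest_nbrs_broom[OF assms]
  by (intro exI[of _ "{{u, v} |u v. u \<in> broom_verts k m \<and> v \<in> broom_verts k m - {u} \<and>
    hopdist (broom k m) u v > enat k}"] exI[of _ "\<lambda>u. broom_verts k m - {u}"]) simp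

text \<open>Every pair of leaves at opposite ends is more than \<open>k\<close> hops apart, and
  different pairs give different unordered shortcuts because the two sets of leaves are
  disjoint.\<close>

lemma greedy_output_broom_card:
  assumes "k \<ge> 1" "greedy_output k (card (broom_verts k m) - 1) (broom k m) S"
  shows "card S \<ge> m\<^sup>2"
proof -
  obtain N where nbrs: "\<forall>u\<in>broom_verts k m.
      nearest_nbrs (card (broom_verts k m) - 1) (broom k m) u (N u)"
    and S: "S = {{u, v} | u v. u \<in> broom_verts k m \<and> v \<in> N u \<and> hopdist (broom k m) u v > enat k}"
    using assms(2) unfolding greedy_output_def verts_broom by blast
  have N: "N u = broom_verts k m - {u}" if "u \<in> broom_verts k m" for u
    using nbrs nearest_nbrs_broom[OF assms(1) that] that by blast
  let ?I = "left_leaves k m \<times> right_leaves k m"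
  have "S \<subseteq> Pow (broom_verts k m)" using N by (auto simp: S)
  then have fin: "finite S" by (rule finite_subset) simp
  have disj: "left_leaves k m \<inter> right_leaves k m = {}"
    by (auto simp: left_leaves_def right_leaves_def)
  then have inj: "inj_on (\<lambda>(a, b). {a, b}) ?I"
    by (auto simp: inj_on_def doubleton_eq_iff)
  have "{a, b} \<in> S" if "a \<in> left_leaves k m" "b \<in> right_leaves k m" for a b
  proof -
    have ab: "a \<in> broom_verts k m" "b \<in> broom_verts k m" using that leaves_subset by blast+
    moreover have "b \<noteq> a" using that disj by blast
    ultimately have "b \<in> N a" "hopdist (broom k m) a b > enat k"
      using broom_dist_leaves[OF that] N assms(1) by (simp_all add: hopdist_broom)
    then show ?thesis using ab(1) unfolding S by blast
  qed
  then have "(\<lambda>(a, b). {a, b}) ` ?I \<subseteq> S" by auto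
  then have "card ?I \<le> card S" by (rule card_inj_on_le[OF inj _ fin])
  then show ?thesis
    by (simp add: left_leaves_def right_leaves_def card_cartesian_product power2_eq_square)
qed

section \<open>Dynamic-program shortcuts on the broom\<close>

lemma dp_output_broom_exists:
  assumes "k \<ge> 1"
  shows "\<exists>S. dp_output k (card (broom_verts k m) - 1) (broom k m) S"
proof -
  have "\<exists>T. sp_tree (card (broom_verts k m) - 1) (broom k m) s T" if "s \<in> broom_verts k m" for s
    using unit_levels.sp_tree_exists[OF unit_levels_broom[OF assms that]] by simp
  then obtain T where T: "\<And>s. s \<in> broom_verts k m \<Longrightarrow>
      sp_tree (card (broom_verts k m) - 1) (broom k m) s (T s)"
    by metis
  then have "\<exists>X. dp_choice k (T s) X" if "s \<in> broom_verts k m" for s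
    using that by (intro dp_choice_exists) (auto simp: sp_tree_def)
  then obtain X where "\<And>s. s \<in> broom_verts k m \<Longrightarrow> dp_choice k (T s) (X s)" by metis
  then show ?thesis using T
    unfolding dp_output_def by (intro exI[of _ "\<Union>s\<in>broom_verts k m. (\<lambda>u. {s, u}) ` X s"]
      exI[of _ T] exI[of _ X]) simp
qed

text \<open>Each leaf needs a shortcut of its own towards the opposite end, so the output covers all
  \<open>2 * m\<close> leaves. A shortcut may be shared by the two leaves it joins, whence only half
  as many are guaranteed.\<close>

lemma dp_output_broom_card:
  assumes "k \<ge> 2" "dp_output k (card (broom_verts k m) - 1) (broom k m) S"
  shows "card S \<ge> m"
proof -
  obtain T X where TX: "\<And>s. s \<in> broom_verts k m \<Longrightarrow>
      sp_tree (card (broom_verts k m) - 1) (broom k m) s (T s) \<and> dp_choice k (T s) (X s)"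
    and S: "S = (\<Union>s\<in>broom_verts k m. (\<lambda>u. {s, u}) ` X s)"
    using assms(2) by (auto simp: dp_output_def)
  have nonempty: "X s \<noteq> {}"
    if "s \<in> broom_verts k m" "v \<in> broom_verts k m" "broom_dist k m s v = Suc k" for s v
  proof -
    interpret unit_levels "broom k m" s "broom_dist k m s"
      using unit_levels_broom assms(1) that(1) by simp
    show ?thesis using sp_tree_choice_nonempty[of "T s" k "X s" v] TX[of s] that assms(1) by simp
  qed
  let ?L = "left_leaves k m \<union> right_leaves k m"
  have cover: "?L \<subseteq> \<Union>S"
  proof
    fix s assume s: "s \<in> ?L"
    \<comment> \<open>One leaf already gives \<open>m \<ge> 1\<close>, so there is a leaf at the
      opposite end.\<close>
    then have "left_leaves k m \<noteq> {}" "right_leaves k m \<noteq> {}"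
      by (auto simp: left_leaves_def right_leaves_def)
    then have "\<exists>v\<in>?L. broom_dist k m s v = Suc k"
      using s broom_dist_leaves by blast
    then have "X s \<noteq> {}" using nonempty s leaves_subset by blast
    then show "s \<in> \<Union>S" using s leaves_subset by (fastforce simp: S)
  qed
  have "X s \<subseteq> broom_verts k m" if "s \<in> broom_verts k m" for s
    using TX[OF that] nearest_nbrs_broom[of k s m] assms(1) that
    by (auto simp: dp_choice_def sp_tree_def)
  then have "S \<subseteq> Pow (broom_verts k m)" by (auto simp: S)
  then have "\<Union>S \<subseteq> broom_verts k m" by blast
  then have fin: "finite (\<Union>S)" by (rule finite_subset) simp
  have "card ?L = 2 * m"
    by (subst card_Un_disjoint) (auto simp: left_leaves_def right_leaves_def)
  then have "2 * m \<le> card (\<Union>S)" using card_mono[OF fin cover] by simp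
  also have "\<dots> \<le> (\<Sum>e\<in>S. card e)" by (rule card_Union_le_sum_card)
  also have "\<dots> \<le> (\<Sum>e\<in>S. 2)"
    by (intro sum_mono) (auto simp: S card_insert_if)
  finally show ?thesis by simp
qed

theorem theorem13:
  fixes k :: nat
  assumes "k \<ge> 3"
  shows "\<exists>(\<rho> :: nat \<Rightarrow> nat) (G :: nat \<Rightarrow> nat wgraph).
    (\<forall>n. wf_wgraph (G n) \<and> (\<exists>S. msp_feasible k (\<rho> n) (G n) S) \<and> msp_opt k (\<rho> n) (G n) > 0) \<and>
    (\<lambda>n. real (card (verts (G n)))) \<in> \<Theta>(\<lambda>n. real n) \<and>
    (\<forall>n. (\<exists>S. dp_output k (\<rho> n) (G n) S) \<and>
         (\<forall>S. dp_output k (\<rho> n) (G n) S \<longrightarrow> approx_ratio k (\<rho> n) (G n) S \<ge> real n - 1)) \<and>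
    (\<forall>n. \<exists>S. greedy_output k (\<rho> n) (G n) S) \<and>
    (\<forall>S. (\<forall>n. greedy_output k (\<rho> n) (G n) (S n)) \<longrightarrow>
         (\<lambda>n. approx_ratio k (\<rho> n) (G n) (S n)) \<in> \<Omega>(\<lambda>n. real n ^ 2))"
proof -
  \<comment> \<open>The successor keeps a leaf at each end even for \<open>n = 0\<close>, so the
    optimum is \<open>1\<close> for every \<open>n\<close>.\<close>
  define m where "m n = Suc n" for n :: nat
  define \<rho> where "\<rho> n = card (broom_verts k (m n)) - 1" for n
  define G where "G n = broom k (m n)" for n
  have k: "k \<ge> 1" "k \<ge> 2" using assms by simp_all
  have opt: "msp_opt k (\<rho> n) (G n) = 1" for n
    unfolding \<rho>_def G_def by (rule msp_opt_broom) (use assms in \<open>simp_all add: m_def\<close>)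
  have ratio: "approx_ratio k (\<rho> n) (G n) S = real (card S)" for n S
    by (simp add: approx_ratio_def opt)
  have feasible: "\<exists>S. msp_feasible k (\<rho> n) (G n) S" for n
    unfolding \<rho>_def G_def using msp_feasible_broom_opt assms by blast
  have theta: "(\<lambda>n. real (card (verts (G n)))) \<in> \<Theta>(\<lambda>n. real n)"
  proof (rule bigthetaI')
    show "eventually (\<lambda>n. 1 * norm (real n) \<le> norm (real (card (verts (G n)))) \<and>
        norm (real (card (verts (G n)))) \<le> real (k + 4) * norm (real n)) at_top"
    proof (intro eventually_sequentiallyI[of 1] conjI)
      fix n :: nat assume n: "n \<ge> 1"
      have c: "card (verts (G n)) = k + 2 * Suc n" by (simp add: G_def m_def broom_verts_def)
      then show "1 * norm (real n) \<le> norm (real (card (verts (G n))))" by simp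
      \<comment> \<open>The constant \<open>k + 4\<close> absorbs the additive \<open>k + 2\<close>
        into a multiple of \<open>n\<close>, which needs \<open>n \<ge> 1\<close>.\<close>
      have "(k + 2) * 1 \<le> (k + 2) * n" using n by (intro mult_le_mono2)
      then have "card (verts (G n)) \<le> (k + 4) * n"
        unfolding c by (simp add: algebra_simps)
      then show "norm (real (card (verts (G n)))) \<le> real (k + 4) * norm (real n)"
        by (metis norm_of_nat of_nat_le_iff of_nat_mult)
    qed
  qed simp_all
  have dp: "approx_ratio k (\<rho> n) (G n) S \<ge> real n - 1" if "dp_output k (\<rho> n) (G n) S" for n S
  proof -
    have "m n \<le> card S"
      using dp_output_broom_card[OF k(2)] that unfolding \<rho>_def G_def by blast
    then show ?thesis by (simp add: ratio m_def)
  qed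
  have greedy: "(\<lambda>n. approx_ratio k (\<rho> n) (G n) (S n)) \<in> \<Omega>(\<lambda>n. real n ^ 2)"
    if S: "\<And>n. greedy_output k (\<rho> n) (G n) (S n)" for S
    unfolding bigomega_iff_bigo
  proof (rule landau_o.bigI[of 1])
    have "real n ^ 2 \<le> real (card (S n))" for n
    proof -
      have "n\<^sup>2 \<le> (m n)\<^sup>2" by (simp add: m_def power_mono)
      also have "\<dots> \<le> card (S n)"
        using greedy_output_broom_card[OF k(1)] S unfolding \<rho>_def G_def by blast
      finally show ?thesis by (metis of_nat_le_iff of_nat_power)
    qed
    then show "eventually (\<lambda>n. norm (real n ^ 2) \<le> 1 * norm (approx_ratio k (\<rho> n) (G n) (S n))) at_top"
      by (simp add: ratio)
  qed simp
  have outputs: "\<exists>S. dp_output k (\<rho> n) (G n) S" "\<exists>S. greedy_output k (\<rho> n) (G n) S" for n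
    unfolding \<rho>_def G_def using dp_output_broom_exists greedy_output_broom_exists k(1) by blast+
  have wf: "wf_wgraph (G n)" for n unfolding G_def by (rule wf_broom)
  show ?thesis
    using feasible theta dp greedy outputs wf opt
    by (intro exI[of _ \<rho>] exI[of _ G]) simp
qed

end
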